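(* Let $F$ be a finite field with $q$ elements and $n$ a positive integer. For every matrix $X \in M_n(F)$ of rank $r \leq n$, we have $$\mathrm{Prob}_X(M_n(F))=\sum_{k=r}^n\frac{ \left(\prod_{i=0}^{k-r-1}\frac{q^{n-r}-q^i}{q^{k-r}-q^i}\right) \left(\prod_{i=0}^{k-1}(q^n-q^i)\right) }{q^{n(n+k)}}.$$
   Context: $M_n(F)$ is the ring of $n\times n$ matrices over $F$. For a finite ring $R$ and $x \in R$, the multiplication probability is $\mathrm{Prob}_x(R)=\frac{|\{(a,b) \in R^2 : ab=x\}|}{|R|^2}$. Empty products are equal to $1$. *)

theory Defs
  imports "HOL-Library.Cardinality" "HOL-Algebra.Ring" "Jordan_Normal_Form.Matrix" "Jordan_Normal_Form.DL_Rank"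
begin

text \<open>Intended for a finite ring \<open>R\<close>, so that both cardinalities are the true ones.\<close>

definition mult_prob :: "('r, 'm) ring_scheme \<Rightarrow> 'r \<Rightarrow> real" where
  "mult_prob R x =
     real (card {(a, b). a \<in> carrier R \<and> b \<in> carrier R \<and> a \<otimes>\<^bsub>R\<^esub> b = x})
       / (real (card (carrier R)))\<^sup>2"

end

theory Submission
  imports Defs "HOL-Library.Function_Algebras" "HOL-Library.FuncSet"
begin

text \<open>
  Fix \<open>A\<close> and count the matrices \<open>B\<close> with \<open>A * B = X\<close>. Each column of \<open>B\<close> solves a linear
  system with coefficient matrix \<open>A\<close>, so there is a solution if and only if the column space
  \<open>U\<close> of \<open>X\<close> is contained in that of \<open>A\<close>. In that case, if \<open>A\<close> has rank \<open>k\<close>, there are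
  \<open>q ^ (n - k)\<close> solutions per column, hence \<open>q ^ (n * (n - k))\<close> matrices \<open>B\<close>
  (\<open>card_matrix_equation_solutions\<close>).

  It remains to count the matrices \<open>A\<close> of rank \<open>k\<close> whose column space contains the
  \<open>r\<close>-dimensional space \<open>U\<close> (\<open>card_lists_span_superset\<close>). A Gaussian binomial coefficient
  counts the \<open>k\<close>-dimensional spaces containing \<open>U\<close>, and each of them is spanned by
  \<open>(\<Prod>i<k. q ^ n - q ^ i)\<close> lists of \<open>n\<close> columns. In the proof both facts come out of a single
  count of lists of vectors by the size of their span (\<open>card_lists_span\<close>), combined with a double
  counting argument. Dividing by the number \<open>q ^ (2 * n * n)\<close> of all pairs of matrices gives
  the summand for \<open>k\<close>.

  Dimensions are expressed through cardinalities: a \<open>k\<close>-dimensional space has \<open>q ^ k\<close> elements.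
  The rank enters only through the column space of \<open>X\<close>, which has \<open>q ^ r\<close> elements
  (\<open>card_span_cols\<close>).
\<close>

section \<open>Gaussian binomial coefficients\<close>

text \<open>The Gaussian binomial coefficient at a real number \<open>q > 1\<close>, in the form in which it arises
  as a quotient of two counts of linearly independent lists. The factor with \<open>i = m\<close> makes it
  vanish for \<open>j > m\<close>.\<close>

definition gauss_binomial :: "real \<Rightarrow> nat \<Rightarrow> nat \<Rightarrow> real" where
  "gauss_binomial q m j = (\<Prod>i<j. (q ^ m - q ^ i) / (q ^ j - q ^ i))"

lemma prod_power_diff_Suc:
  fixes q :: real
  shows "(\<Prod>i<Suc j. (q ^ Suc m - q ^ i)) = (q ^ Suc m - 1) * q ^ j * (\<Prod>i<j. (q ^ m - q ^ i))"
proof -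
  have "(\<Prod>i<Suc j. (q ^ Suc m - q ^ i)) = (q ^ Suc m - 1) * (\<Prod>i<j. (q ^ Suc m - q ^ Suc i))"
    by (simp only: prod.lessThan_Suc_shift power_0)
  also have "(\<Prod>i<j. (q ^ Suc m - q ^ Suc i)) = (\<Prod>i<j. q * (q ^ m - q ^ i))"
    by (simp add: algebra_simps)
  also have "\<dots> = q ^ j * (\<Prod>i<j. (q ^ m - q ^ i))"
    by (simp add: prod.distrib)
  finally show ?thesis by simp
qed

lemma prod_power_diff_nonzero:
  fixes q :: real
  assumes "q > 1"
  shows "(\<Prod>i<j. (q ^ j - q ^ i)) \<noteq> 0"
  using assms by (auto simp: power_inject_exp)

lemma gauss_binomial_0_right [simp]: "gauss_binomial q m 0 = 1"
  by (simp add: gauss_binomial_def)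

lemma gauss_binomial_eq_0: "m < j \<Longrightarrow> gauss_binomial q m j = 0"
  unfolding gauss_binomial_def by (rule prod_zero) auto

lemma gauss_binomial_mult_prod:
  assumes "q > 1"
  shows "gauss_binomial q m j * (\<Prod>i<j. (q ^ j - q ^ i)) = (\<Prod>i<j. (q ^ m - q ^ i))"
  using prod_power_diff_nonzero[OF assms, of j]
  by (simp add: gauss_binomial_def prod_dividef)

text \<open>The \<open>q\<close>-analogue of Pascal's rule.\<close>

lemma gauss_binomial_Suc_Suc:
  assumes "q > 1"
  shows "gauss_binomial q (Suc m) (Suc j) =
           q ^ Suc j * gauss_binomial q m (Suc j) + gauss_binomial q m j"
proof -
  let ?D = "\<lambda>j. \<Prod>i<j. (q ^ j - q ^ i)"
  let ?P = "\<lambda>m j. \<Prod>i<j. (q ^ m - q ^ i)"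
  have D: "?D (Suc j) \<noteq> 0" by (rule prod_power_diff_nonzero[OF assms])
  have "gauss_binomial q (Suc m) (Suc j) * ?D (Suc j) = ?P (Suc m) (Suc j)"
    by (rule gauss_binomial_mult_prod[OF assms])
  also have "\<dots> = (q ^ Suc m - 1) * q ^ j * ?P m j"
    by (rule prod_power_diff_Suc)
  also have "\<dots> = q ^ Suc j * (?P m j * (q ^ m - q ^ j)) + (q ^ Suc j - 1) * q ^ j * ?P m j"
    by (simp add: algebra_simps)
  also have "?P m j * (q ^ m - q ^ j) = ?P m (Suc j)" by simp
  also have "\<dots> = gauss_binomial q m (Suc j) * ?D (Suc j)"
    by (rule gauss_binomial_mult_prod[OF assms, symmetric])
  also have "(q ^ Suc j - 1) * q ^ j * ?P m j = gauss_binomial q m j * ((q ^ Suc j - 1) * q ^ j * ?D j)"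
    using gauss_binomial_mult_prod[OF assms, of m j] by simp
  also have "(q ^ Suc j - 1) * q ^ j * ?D j = ?D (Suc j)"
    by (rule prod_power_diff_Suc[symmetric])
  finally have "gauss_binomial q (Suc m) (Suc j) * ?D (Suc j) =
      (q ^ Suc j * gauss_binomial q m (Suc j) + gauss_binomial q m j) * ?D (Suc j)"
    by (simp only: algebra_simps)
  with D show ?thesis by (simp only: mult_cancel_right) simp
qed

section \<open>Lists of vectors over a finite field\<close>

lemma card_Cons_Sigma:
  assumes "finite A" "\<And>ws. ws \<in> A \<Longrightarrow> finite (B ws)"
  shows "card {w # ws |w ws. ws \<in> A \<and> w \<in> B ws} = (\<Sum>ws\<in>A. card (B ws))"
proof -
  have "{w # ws |w ws. ws \<in> A \<and> w \<in> B ws} = (\<lambda>(ws, w). w # ws) ` (SIGMA ws:A. B ws)"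
    by force
  moreover have "inj_on (\<lambda>(ws, w). w # ws) (SIGMA ws:A. B ws)"
    by (auto simp: inj_on_def)
  ultimately show ?thesis
    using assms by (simp add: card_image)
qed

text \<open>A vector space over a field with \<open>q\<close> elements. The space itself may be infinite; the
  size of a finite subspace is recorded by its cardinality \<open>q ^ k\<close> instead of its dimension \<open>k\<close>.\<close>

locale finite_field_vector_space = vector_space scale
  for scale :: "'a :: {field, finite} \<Rightarrow> 'b :: ab_group_add \<Rightarrow> 'b"  (infixr \<open>*s\<close> 75) +
  fixes q :: nat
  assumes q_eq_card: "q = CARD('a)"
begin

lemma q_gt_1: "q > 1"
proof -
  have "card {0 :: 'a, 1} \<le> q" unfolding q_eq_card by (rule card_mono) auto
  then show ?thesis by simp
qed

lemma span_insert_eq_image: "span (insert v S) = (\<lambda>(c, s). c *s v + s) ` (UNIV \<times> span S)"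
proof (rule Set.set_eqI)
  fix x
  have "x \<in> span (insert v S) \<longleftrightarrow> (\<exists>c. x - c *s v \<in> span S)" by (rule span_breakdown_eq)
  also have "\<dots> \<longleftrightarrow> (\<exists>c. \<exists>s\<in>span S. x = c *s v + s)"
    by (metis add_diff_cancel_left' diff_add_cancel add.commute)
  finally show "x \<in> span (insert v S) \<longleftrightarrow> x \<in> (\<lambda>(c, s). c *s v + s) ` (UNIV \<times> span S)"
    by auto
qed

lemma scale_diff_in_span:
  assumes "v \<notin> span S" "x - c *s v \<in> span S" "x - d *s v \<in> span S"
  shows "c = d"
proof (rule ccontr)
  assume "c \<noteq> d"
  have "(x - d *s v) - (x - c *s v) \<in> span S" by (rule span_diff[OF assms(3,2)])
  then have "(c - d) *s v \<in> span S" by (simp add: scale_left_diff_distrib)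
  then have "inverse (c - d) *s ((c - d) *s v) \<in> span S" by (rule span_scale)
  with \<open>c \<noteq> d\<close> assms show False by simp
qed

lemma finite_span [simp]:
  assumes "finite S" shows "finite (span S)"
  using assms by (induction S) (simp_all add: span_insert_eq_image)

lemma card_span_insert:
  assumes "v \<notin> span S"
  shows "card (span (insert v S)) = q * card (span S)"
proof -
  have "inj_on (\<lambda>(c, s). c *s v + s) (UNIV \<times> span S)"
  proof (rule inj_onI, clarify)
    fix c s d t assume st: "s \<in> span S" "t \<in> span S" and eq: "c *s v + s = d *s v + t"
    have "c = d"
    proof (rule scale_diff_in_span[OF assms, of "c *s v + s"])
      show "c *s v + s - c *s v \<in> span S" using st by simp
      show "c *s v + s - d *s v \<in> span S" unfolding eq using st by simp
    qed
    with eq show "c = d \<and> s = t" by simp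
  qed
  then show ?thesis
    by (simp add: span_insert_eq_image card_image card_cartesian_product q_eq_card)
qed

lemma card_span_power:
  assumes "finite S"
  shows "\<exists>k. card (span S) = q ^ k"
  using assms
proof (induction S)
  case empty
  show ?case by (auto intro: exI[of _ 0])
next
  case (insert v S)
  then obtain k where k: "card (span S) = q ^ k" by blast
  show ?case
  proof (cases "v \<in> span S")
    case True
    then show ?thesis using k by (auto simp: span_redundant)
  next
    case False
    then have "card (span (insert v S)) = q ^ Suc k" using k by (simp add: card_span_insert)
    then show ?thesis by blast
  qed
qed

text \<open>The lists of vectors of length \<open>m\<close> with all entries in \<open>V\<close>.\<close>

abbreviation lists_of :: "nat \<Rightarrow> 'b set \<Rightarrow> 'b list set" where
  "lists_of m V \<equiv> {ws. set ws \<subseteq> V \<and> length ws = m}"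

text \<open>Lists are built one vector at a time. A further vector either lies in the span \<open>S\<close> reached
  so far, which leaves \<open>card S\<close> choices and does not change \<open>S\<close>, or it lies outside, which leaves
  \<open>card V - card S\<close> choices and multiplies \<open>card S\<close> by \<open>q\<close>. The resulting recurrence is the
  \<open>q\<close>-Pascal rule.\<close>

lemma card_lists_span:
  assumes "subspace V" "finite V" "card V = q ^ N"
    and "subspace U" "U \<subseteq> V" "card U = q ^ r"
  shows "real (card {ws \<in> lists_of m V. card (span (U \<union> set ws)) = q ^ (r + j)}) =
    gauss_binomial q m j * q ^ (r * (m - j)) * (\<Prod>i<j. (real q ^ N - real q ^ (r + i)))"
proof (induction m arbitrary: j)
  case 0
  have *: "{ws \<in> lists_of 0 V. card (span (U \<union> set ws)) = q ^ (r + j)} = (if j = 0 then {[]} else {})"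
    using assms q_gt_1 by (auto simp: span_eq_iff[THEN iffD2] power_inject_exp)
  show ?case unfolding * by (auto simp: gauss_binomial_eq_0)
next
  case (Suc m)
  let ?c = "\<lambda>ws. card (span (U \<union> set ws))"
  let ?T = "\<lambda>m j. {ws \<in> lists_of m V. ?c ws = q ^ (r + j)}"
  let ?A = "{w # ws |w ws. ws \<in> ?T m j \<and> w \<in> span (U \<union> set ws)}"
  have fin: "finite (?T m j)" for m j
    using finite_lists_length_eq[OF assms(2), of m] by (auto intro: finite_subset[rotated])
  have sub: "span (U \<union> set ws) \<subseteq> V" if "ws \<in> ?T m j" for ws m j
    by (rule span_minimal) (use that assms in auto)
  have finU: "finite U" using assms finite_subset by blast
  have finspan: "finite (span (U \<union> set ws))" for ws using finU by simp
  have cardA: "real (card ?A) = real q ^ (r + j) * card (?T m j)"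
    using fin[of m j] finspan by (subst card_Cons_Sigma) auto
  show ?case
  proof (cases j)
    case 0
    have "?T (Suc m) j = ?A"
    proof (intro equalityI subsetI)
      fix xs assume xs: "xs \<in> ?T (Suc m) j"
      then obtain w ws where [simp]: "xs = w # ws" by (auto simp: length_Suc_conv)
      have ws: "set ws \<subseteq> V" "w \<in> V" "length ws = m" and c: "card (span (insert w (U \<union> set ws))) = q ^ r"
        using xs 0 by auto
      have ge: "q ^ r \<le> ?c ws"
        using card_mono[OF finspan, of U ws] assms(6) span_superset[of "U \<union> set ws"] by auto
      moreover have "0 < q ^ r" using q_gt_1 by simp
      ultimately have "?c ws > 0" by linarith
      have w: "w \<in> span (U \<union> set ws)"
      proof (rule ccontr)
        \<comment> \<open>Otherwise the span of \<open>U\<close> and \<open>ws\<close> would be smaller than \<open>U\<close>.\<close>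
        assume "w \<notin> span (U \<union> set ws)"
        then have "q ^ r = q * ?c ws" using card_span_insert[of w "U \<union> set ws"] c by simp
        moreover have "2 * ?c ws \<le> q * ?c ws" using q_gt_1 by (intro mult_le_mono1) simp
        ultimately show False using ge \<open>?c ws > 0\<close> by linarith
      qed
      then have "?c ws = q ^ (r + j)" using c 0 by (simp add: span_redundant)
      then show "xs \<in> ?A" using w ws by auto
    next
      fix xs assume "xs \<in> ?A"
      then obtain w ws where "xs = w # ws" "ws \<in> ?T m j" "w \<in> span (U \<union> set ws)" by blast
      then show "xs \<in> ?T (Suc m) j" using sub[of ws m j] by (auto simp: span_redundant)
    qed
    then show ?thesis using cardA Suc.IH[of j] 0 by (simp add: power_add)
  next
    case (Suc i)
    let ?B = "{w # ws |w ws. ws \<in> ?T m i \<and> w \<in> V - span (U \<union> set ws)}"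
    have "?T (Suc m) j = ?A \<union> ?B"
    proof (intro equalityI subsetI)
      fix xs assume xs: "xs \<in> ?T (Suc m) j"
      then obtain w ws where [simp]: "xs = w # ws" by (auto simp: length_Suc_conv)
      have ws: "set ws \<subseteq> V" "w \<in> V" "length ws = m" and c: "card (span (insert w (U \<union> set ws))) = q ^ (r + j)"
        using xs by auto
      show "xs \<in> ?A \<union> ?B"
      proof (cases "w \<in> span (U \<union> set ws)")
        case True
        then show ?thesis using c ws by (auto simp: span_redundant)
      next
        case False
        have "q * ?c ws = q * q ^ (r + i)"
          unfolding card_span_insert[OF False, symmetric] c Suc by simp
        then have "?c ws = q ^ (r + i)" using q_gt_1 by (metis less_nat_zero_code mult_cancel1)
        then have "ws \<in> ?T m i" using ws by simp
        then show ?thesis using False ws(2) \<open>xs = w # ws\<close> by blast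
      qed
    next
      fix xs assume "xs \<in> ?A \<union> ?B"
      then consider w ws where "xs = w # ws" "ws \<in> ?T m j" "w \<in> span (U \<union> set ws)"
        | w ws where "xs = w # ws" "ws \<in> ?T m i" "w \<in> V - span (U \<union> set ws)" by blast
      then show "xs \<in> ?T (Suc m) j"
      proof cases
        case 1
        then show ?thesis using sub[of ws m j] by (auto simp: span_redundant)
      next
        case 2
        then have "?c (w # ws) = q ^ (r + j)" using card_span_insert[of w "U \<union> set ws"] Suc by simp
        then show ?thesis using 2 by simp
      qed
    qed
    moreover have "?A \<inter> ?B = {}" by auto
    moreover have "finite ?A" "finite ?B"
      by (rule finite_subset[OF _ fin[of "Suc m" j]]; use calculation in blast)+
    ultimately have card: "card (?T (Suc m) j) = card ?A + card ?B"
      by (simp add: card_Un_disjoint)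
    have "real (card ?B) = (\<Sum>ws\<in>?T m i. real (card (V - span (U \<union> set ws))))"
      using fin[of m i] assms(2) by (subst card_Cons_Sigma) auto
    also have "\<dots> = (\<Sum>ws\<in>?T m i. real q ^ N - real q ^ (r + i))"
    proof (rule sum.cong)
      fix ws assume ws: "ws \<in> ?T m i"
      have "card (V - span (U \<union> set ws)) = q ^ N - q ^ (r + i)"
        using ws sub[OF ws] finspan assms(3) by (subst card_Diff_subset) auto
      moreover have "q ^ (r + i) \<le> q ^ N"
        using card_mono[OF assms(2) sub[OF ws]] ws assms(3) by auto
      ultimately show "real (card (V - span (U \<union> set ws))) = real q ^ N - real q ^ (r + i)"
        by (simp add: of_nat_diff)
    qed simp
    also have "\<dots> = (real q ^ N - real q ^ (r + i)) * card (?T m i)" by simp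
    finally have cardB: "real (card ?B) = (real q ^ N - real q ^ (r + i)) * card (?T m i)" .
    let ?P = "\<Prod>i<j. (real q ^ N - real q ^ (r + i))"
    let ?g = "gauss_binomial q"
    have "real (card (?T (Suc m) j)) = real q ^ (r + j) * (?g m j * real q ^ (r * (m - j)) * ?P)
       + (real q ^ N - real q ^ (r + i)) * (?g m i * real q ^ (r * (m - i)) * (\<Prod>i<i. (real q ^ N - real q ^ (r + i))))"
      unfolding card of_nat_add cardA cardB Suc.IH by simp
    also have "(real q ^ N - real q ^ (r + i)) * (?g m i * real q ^ (r * (m - i)) * (\<Prod>i<i. (real q ^ N - real q ^ (r + i))))
       = ?g m i * real q ^ (r * (m - i)) * ?P" using Suc by simp
    also have "real q ^ (r + j) * (?g m j * real q ^ (r * (m - j)) * ?P) = real q ^ j * ?g m j * real q ^ (r * (m - i)) * ?P"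
    \<comment> \<open>For \<open>j > m\<close> the exponent \<open>m - j\<close> is truncated, but there both sides vanish.\<close>
    proof (cases "j \<le> m")
      case True
      then have "m - i = Suc (m - j)" using Suc by simp
      then show ?thesis by (simp add: power_add algebra_simps)
    qed (simp add: gauss_binomial_eq_0)
    also have "real q ^ j * ?g m j * real q ^ (r * (m - i)) * ?P + ?g m i * real q ^ (r * (m - i)) * ?P
       = ?g (Suc m) j * real q ^ (r * (Suc m - j)) * ?P"
      using gauss_binomial_Suc_Suc[of q m i] q_gt_1 Suc by (simp add: algebra_simps)
    finally show ?thesis by simp
  qed
qed

text \<open>The case \<open>U = {0}\<close> of \<open>card_lists_span\<close> for lists that span the whole space, where
  the denominator of the Gaussian binomial coefficient cancels.\<close>

lemma card_spanning_lists:
  assumes "subspace S" "finite S" "card S = q ^ k"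
  shows "real (card {ws \<in> lists_of m S. span (set ws) = S}) = (\<Prod>i<k. (real q ^ m - real q ^ i))"
proof -
  have "span (set ws) = S \<longleftrightarrow> card (span ({0} \<union> set ws)) = q ^ (0 + k)" if "ws \<in> lists_of m S" for ws
  proof -
    have "span (set ws) \<subseteq> S" by (rule span_minimal) (use that assms in auto)
    then have "span (set ws) = S" if "card (span (set ws)) = q ^ k"
      using that assms by (intro card_subset_eq) simp_all
    then show ?thesis using assms by auto
  qed
  then have "{ws \<in> lists_of m S. span (set ws) = S} =
      {ws \<in> lists_of m S. card (span ({0} \<union> set ws)) = q ^ (0 + k)}" by blast
  then have "real (card {ws \<in> lists_of m S. span (set ws) = S}) =
      gauss_binomial q m k * (\<Prod>i<k. (real q ^ k - real q ^ i))"
    using card_lists_span[OF assms, of "{0}" 0 m k] subspace_0[OF assms(1)] by simp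
  then show ?thesis using gauss_binomial_mult_prod[of q m k] q_gt_1 by simp
qed

text \<open>The case \<open>j = m\<close> of \<open>card_lists_span\<close>: each of the \<open>k - r\<close> vectors lies outside the span of \<open>U\<close> and the others.\<close>

lemma card_extending_lists:
  assumes "subspace S" "finite S" "card S = q ^ N"
    and "subspace U" "U \<subseteq> S" "card U = q ^ r" "r \<le> k"
  shows "real (card {us \<in> lists_of (k - r) S. card (span (U \<union> set us)) = q ^ k}) =
    (\<Prod>i<k - r. (real q ^ N - real q ^ (r + i)))"
proof -
  have "gauss_binomial q (k - r) (k - r) = 1"
    using gauss_binomial_mult_prod[of q "k - r" "k - r"] prod_power_diff_nonzero[of q "k - r"] q_gt_1
    by simp
  then show ?thesis
    using card_lists_span[OF assms(1-6), of "k - r" "k - r"] assms(7) by simp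
qed

text \<open>Count in two ways the pairs of a list \<open>us\<close> that extends \<open>U\<close> independently to a space
  with \<open>q ^ k\<close> elements, and a list \<open>ws\<close> of length \<open>m\<close> that spans this space. Starting from
  \<open>us\<close>, one chooses a spanning list of a given space; starting from \<open>ws\<close>, one chooses an
  extension of \<open>U\<close> within a given space. This way the intermediate spaces need not be counted.\<close>

lemma card_lists_span_superset:
  assumes "subspace V" "finite V" "card V = q ^ n"
    and "subspace U" "U \<subseteq> V" "card U = q ^ r" "r \<le> k"
  shows "real (card {ws \<in> lists_of m V. U \<subseteq> span (set ws) \<and> card (span (set ws)) = q ^ k}) =
    (\<Prod>i<k - r. (real q ^ (n - r) - real q ^ i) / (real q ^ (k - r) - real q ^ i)) *
    (\<Prod>i<k. (real q ^ m - real q ^ i))"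
proof -
  let ?A = "{us \<in> lists_of (k - r) V. card (span (U \<union> set us)) = q ^ k}"
  let ?W = "{ws \<in> lists_of m V. U \<subseteq> span (set ws) \<and> card (span (set ws)) = q ^ k}"
  let ?P = "{(us, ws). us \<in> ?A \<and> ws \<in> ?W \<and> span (set ws) = span (U \<union> set us)}"
  let ?d = "\<lambda>N. \<Prod>i<k - r. (real q ^ N - real q ^ (r + i))"
  let ?f = "\<Prod>i<k. (real q ^ m - real q ^ i)"
  have span_sub: "span A \<subseteq> V" if "A \<subseteq> V" for A
    using that assms(1) by (rule span_minimal)
  have finA: "finite ?A"
    by (rule finite_subset[OF _ finite_lists_length_eq[OF assms(2)]]) auto
  have finW: "finite ?W"
    by (rule finite_subset[OF _ finite_lists_length_eq[OF assms(2), of m]]) auto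
  let ?B = "\<lambda>us. {ws \<in> lists_of m (span (U \<union> set us)). span (set ws) = span (U \<union> set us)}"
  let ?C = "\<lambda>ws. {us \<in> lists_of (k - r) (span (set ws)). card (span (U \<union> set us)) = q ^ k}"
  have finU: "finite U" using assms finite_subset by blast
  have P1: "?P = Sigma ?A ?B"
  proof (intro equalityI subsetI)
    fix p assume "p \<in> ?P"
    then obtain us ws where p: "p = (us, ws)" "us \<in> ?A" "ws \<in> ?W" "span (set ws) = span (U \<union> set us)"
      by blast
    then show "p \<in> Sigma ?A ?B" using span_superset[of "set ws"] by simp
  next
    fix p assume "p \<in> Sigma ?A ?B"
    then obtain us ws where p: "p = (us, ws)" "us \<in> ?A" "ws \<in> ?B us" by blast
    have "span (U \<union> set us) \<subseteq> V" using p assms by (intro span_sub) auto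
    moreover have "U \<subseteq> span (U \<union> set us)" using span_superset[of "U \<union> set us"] by auto
    ultimately show "p \<in> ?P" using p by auto
  qed
  have P2: "prod.swap ` ?P = Sigma ?W ?C"
  proof (intro equalityI subsetI)
    fix p assume "p \<in> prod.swap ` ?P"
    then obtain us ws where p: "p = (ws, us)" "us \<in> ?A" "ws \<in> ?W" "span (set ws) = span (U \<union> set us)"
      by auto
    have "set us \<subseteq> span (set ws)" using p(4) span_superset[of "U \<union> set us"] by auto
    then show "p \<in> Sigma ?W ?C" using p by simp
  next
    fix p assume "p \<in> Sigma ?W ?C"
    then obtain us ws where p: "p = (ws, us)" "ws \<in> ?W" "us \<in> ?C ws" by blast
    have "set us \<subseteq> V" using p span_sub[of "set ws"] by auto
    moreover have "span (U \<union> set us) = span (set ws)"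
    proof (rule card_subset_eq)
      show "span (U \<union> set us) \<subseteq> span (set ws)"
        by (rule span_minimal) (use p in auto)
    qed (use p in auto)
    ultimately have "(us, ws) \<in> ?P" using p by simp
    then show "p \<in> prod.swap ` ?P" unfolding p(1) by force
  qed
  have cardB: "real (card (?B us)) = ?f" if "us \<in> ?A" for us
    by (rule card_spanning_lists) (use that finU in auto)
  have finB: "finite (?B us)" for us
    by (rule finite_subset[OF _ finite_lists_length_eq[of "span (U \<union> set us)" m]]) (use finU in auto)
  have "real (card ?P) = (\<Sum>us\<in>?A. real (card (?B us)))"
    unfolding P1 using finA finB by (subst card_SigmaI) auto
  also have "\<dots> = card ?A * ?f"
    using cardB by simp
  also have "real (card ?A) = ?d n"
    by (rule card_extending_lists[OF assms])
  finally have card1: "real (card ?P) = ?d n * ?f" .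
  have cardC: "real (card (?C ws)) = ?d k" if "ws \<in> ?W" for ws
    by (rule card_extending_lists) (use that assms in auto)
  have finC: "finite (?C ws)" for ws
    by (rule finite_subset[OF _ finite_lists_length_eq[of "span (set ws)" "k - r"]]) auto
  have "card ?P = card (prod.swap ` ?P)"
    by (rule card_image[symmetric]) (simp add: inj_on_def)
  then have "real (card ?P) = (\<Sum>ws\<in>?W. real (card (?C ws)))"
    unfolding P2 using finW finC by (subst (asm) card_SigmaI) auto
  also have "\<dots> = card ?W * ?d k"
    using cardC by simp
  finally have eq: "card ?W * ?d k = ?d n * ?f"
    using card1 by simp
  have d: "?d N = q ^ (r * (k - r)) * (\<Prod>i<k - r. (real q ^ (N - r) - real q ^ i))" if "r \<le> N" for N
  proof -
    have "?d N = (\<Prod>i<k - r. real q ^ r * (real q ^ (N - r) - real q ^ i))"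
      using that by (intro prod.cong) (simp_all add: right_diff_distrib flip: power_add)
    then show ?thesis by (simp add: prod.distrib power_mult)
  qed
  have "q ^ r \<le> q ^ n"
    using card_mono[OF assms(2,5)] assms(3,6) by simp
  then have "r \<le> n" using power_le_imp_le_exp[OF q_gt_1] by blast
  then have "card ?W * (\<Prod>i<k - r. (real q ^ (k - r) - real q ^ i)) =
      (\<Prod>i<k - r. (real q ^ (n - r) - real q ^ i)) * ?f"
    using eq q_gt_1 unfolding d[OF \<open>r \<le> k\<close>] d[OF \<open>r \<le> n\<close>] by simp
  then show ?thesis
    using prod_power_diff_nonzero[of q "k - r"] q_gt_1
    by (simp add: prod_dividef nonzero_eq_divide_eq mult.commute)
qed

text \<open>A solvable linear system in \<open>m\<close> unknowns has \<open>q ^ m\<close> divided by the size of the span of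
  its columns solutions.\<close>

lemma card_linear_system_solutions:
  "card {cs. length cs = length ws \<and> (\<Sum>i<length ws. cs ! i *s ws ! i) = x} * card (span (set ws)) =
    (if x \<in> span (set ws) then q ^ length ws else 0)"
proof (induction ws arbitrary: x)
  case Nil
  show ?case by auto
next
  case (Cons w ws)
  let ?N = "\<lambda>x. {cs. length cs = length ws \<and> (\<Sum>i<length ws. cs ! i *s ws ! i) = x}"
  let ?S = "span (set ws)"
  have fin: "finite (?N x)" for x
    by (rule finite_subset[OF _ finite_lists_length_eq[of UNIV "length ws"]]) auto
  have "{cs. length cs = length (w # ws) \<and> (\<Sum>i<length (w # ws). cs ! i *s (w # ws) ! i) = x}
      = (\<lambda>(c, cs). c # cs) ` (SIGMA c:UNIV. ?N (x - c *s w))"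
  proof (intro equalityI subsetI)
    fix cs assume "cs \<in> {cs. length cs = length (w # ws) \<and> (\<Sum>i<length (w # ws). cs ! i *s (w # ws) ! i) = x}"
    then show "cs \<in> (\<lambda>(c, cs). c # cs) ` (SIGMA c:UNIV. ?N (x - c *s w))"
      by (cases cs) (auto simp: sum.lessThan_Suc_shift image_iff simp del: sum.lessThan_Suc)
  qed (auto simp: sum.lessThan_Suc_shift simp del: sum.lessThan_Suc)
  moreover have "inj_on (\<lambda>(c, cs). c # cs) (SIGMA c:UNIV. ?N (x - c *s w))"
    by (auto simp: inj_on_def)
  ultimately have "card {cs. length cs = length (w # ws) \<and> (\<Sum>i<length (w # ws). cs ! i *s (w # ws) ! i) = x}
      = (\<Sum>c\<in>UNIV. card (?N (x - c *s w)))" (is "?L = _")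
    using fin by (simp add: card_image)
  then have *: "?L * card ?S = (\<Sum>c\<in>UNIV. if x - c *s w \<in> ?S then q ^ length ws else 0)"
    by (simp only: sum_distrib_right Cons.IH)
  have **: "x \<in> span (set (w # ws)) \<longleftrightarrow> (\<exists>c. x - c *s w \<in> ?S)"
    by (simp add: span_breakdown_eq)
  show ?case
  proof (cases "w \<in> ?S")
    case True
    have "x - c *s w \<in> ?S \<longleftrightarrow> x \<in> ?S" for c
      using span_add_eq[of "- (c *s w)" "set ws" x] True by (simp add: span_scale span_neg)
    then show ?thesis using * ** True by (auto simp: span_redundant q_eq_card)
  next
    case False
    have "(\<Sum>c\<in>UNIV. if x - c *s w \<in> ?S then q ^ length ws else 0) =
        (if \<exists>c. x - c *s w \<in> ?S then q ^ length ws else 0)"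
    proof (cases "\<exists>c. x - c *s w \<in> ?S")
      case True
      then obtain d where "x - d *s w \<in> ?S" by blast
      then have "x - c *s w \<in> ?S \<longleftrightarrow> c = d" for c
        using scale_diff_in_span[OF False] by blast
      then show ?thesis by simp
    qed simp
    then have "?L * (q * card ?S) = (if x \<in> span (set (w # ws)) then q ^ length (w # ws) else 0)"
      using * unfolding ** by (simp only: mult.left_commute[of _ q]) simp
    then show ?thesis using card_span_insert[OF False] by simp
  qed
qed

end

section \<open>Matrices as lists of columns\<close>

text \<open>Column vectors are encoded as functions on the natural numbers that vanish from index
  \<open>n\<close> on. Such functions form a type that is an additive group, and hence a vector space with
  the following scalar multiplication.\<close>

definition fscale :: "'a \<Rightarrow> (nat \<Rightarrow> 'a) \<Rightarrow> nat \<Rightarrow> 'a :: times" where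
  "fscale c v = (\<lambda>i. c * v i)"

lemma fscale_apply: "fscale c v i = c * v i"
  by (simp add: fscale_def)

interpretation fn: finite_field_vector_space
  "fscale :: 'a :: {field, finite} \<Rightarrow> (nat \<Rightarrow> 'a) \<Rightarrow> nat \<Rightarrow> 'a" "CARD('a)"
  by unfold_locales (auto simp: fun_eq_iff fscale_apply algebra_simps)

text \<open>The copy of the \<open>n\<close>-dimensional coordinate space inside the space of sequences.\<close>

definition coord_space :: "nat \<Rightarrow> (nat \<Rightarrow> 'a :: zero) set" where
  "coord_space n = {v. \<forall>i\<ge>n. v i = 0}"

text \<open>The sequence encoding a vector, extended by zero beyond its dimension.\<close>

definition vec_fun :: "'a :: zero vec \<Rightarrow> nat \<Rightarrow> 'a" where
  "vec_fun v = (\<lambda>i. if i < dim_vec v then v $ i else 0)"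

lemma bij_betw_vec_fun: "bij_betw vec_fun (carrier_vec n) (coord_space n)"
  by (rule bij_betw_byWitness[where f' = "\<lambda>f. vec n f"])
     (auto simp: vec_fun_def coord_space_def fun_eq_iff intro!: eq_vecI)

lemma subspace_coord_space: "fn.subspace (coord_space n)"
  unfolding fn.subspace_def by (auto simp: coord_space_def fscale_apply)

lemma card_coord_space: "card (coord_space n :: (nat \<Rightarrow> 'a :: {zero, finite}) set) = CARD('a) ^ n"
proof -
  have "bij_betw (\<lambda>cs i. if i < n then cs ! i else 0) {cs :: 'a list. length cs = n} (coord_space n)"
    by (rule bij_betw_byWitness[where f' = "\<lambda>f. map f [0..<n]"])
       (auto simp: coord_space_def fun_eq_iff intro!: nth_equalityI)
  then show ?thesis
    using card_lists_length_eq[of "UNIV :: 'a set" n] by (simp flip: bij_betw_same_card)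
qed

lemma finite_coord_space: "finite (coord_space n :: (nat \<Rightarrow> 'a :: {field, finite}) set)"
  by (rule card_ge_0_finite) (simp add: card_coord_space)

lemma bij_betw_cols:
  "bij_betw (\<lambda>A. map vec_fun (cols A)) (carrier_mat n m)
     {ws. set ws \<subseteq> coord_space n \<and> length ws = m}"
proof (rule bij_betw_byWitness[where f' = "\<lambda>ws. mat n m (\<lambda>(i, j). (ws ! j) i)"])
  show "\<forall>A\<in>carrier_mat n m. mat n m (\<lambda>(i, j). (map vec_fun (cols A) ! j) i) = A"
    by (auto simp: vec_fun_def intro!: eq_matI)
  show "\<forall>ws\<in>{ws. set ws \<subseteq> coord_space n \<and> length ws = m}.
      map vec_fun (cols (mat n m (\<lambda>(i, j). (ws ! j) i))) = ws"
  proof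
    fix ws assume ws: "ws \<in> {ws. set ws \<subseteq> coord_space n \<and> length ws = m}"
    then have "ws ! j \<in> coord_space n" if "j < m" for j using that by auto
    then show "map vec_fun (cols (mat n m (\<lambda>(i, j). (ws ! j) i))) = ws"
      using ws by (intro nth_equalityI) (auto simp: vec_fun_def coord_space_def fun_eq_iff)
  qed
  show "(\<lambda>A. map vec_fun (cols A)) ` carrier_mat n m \<subseteq> {ws. set ws \<subseteq> coord_space n \<and> length ws = m}"
    by (auto simp: vec_fun_def coord_space_def dest!: cols_dim[THEN subsetD])
  show "(\<lambda>ws. mat n m (\<lambda>(i, j). (ws ! j) i)) ` {ws. set ws \<subseteq> coord_space n \<and> length ws = m} \<subseteq> carrier_mat n m"
    by auto
qed

lemma mult_mat_eq_iff:
  fixes A B X :: "'a :: {field, finite} mat"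
  assumes "A \<in> carrier_mat n m" "B \<in> carrier_mat m p" "X \<in> carrier_mat n p"
  shows "A * B = X \<longleftrightarrow>
    (\<forall>j<p. (\<Sum>i<m. fscale (B $$ (i, j)) (vec_fun (col A i))) = vec_fun (col X j))"
proof -
  have sum_apply: "(\<Sum>i<m. fscale (B $$ (i, j)) (vec_fun (col A i))) l =
      (\<Sum>i<m. B $$ (i, j) * vec_fun (col A i) l)" for j l
    by (induction m) (auto simp: fscale_apply)
  have "A * B = X \<longleftrightarrow> (\<forall>l<n. \<forall>j<p. (A * B) $$ (l, j) = X $$ (l, j))"
    using assms by (auto simp: mat_eq_iff)
  also have "\<dots> \<longleftrightarrow> (\<forall>l<n. \<forall>j<p. (\<Sum>i<m. B $$ (i, j) * vec_fun (col A i) l) = vec_fun (col X j) l)"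
    using assms by (auto simp: scalar_prod_def vec_fun_def lessThan_atLeast0 mult.commute)
  also have "\<dots> \<longleftrightarrow> (\<forall>j<p. \<forall>l. (\<Sum>i<m. B $$ (i, j) * vec_fun (col A i) l) = vec_fun (col X j) l)"
    using assms by (auto simp: vec_fun_def)
  finally show ?thesis
    by (simp add: fun_eq_iff sum_apply)
qed

text \<open>The columns of \<open>B\<close> solve independent linear systems, all with the columns of \<open>A\<close>
  as coefficients and with the columns of \<open>X\<close> as right-hand sides.\<close>

lemma card_matrix_equation_solutions:
  fixes A X :: "'a :: {field, finite} mat"
  assumes A: "A \<in> carrier_mat n m" and X: "X \<in> carrier_mat n p"
  defines "S \<equiv> fn.span (set (map vec_fun (cols A)))"
  shows "real (card {B \<in> carrier_mat m p. A * B = X}) =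
    (if fn.span (set (map vec_fun (cols X))) \<subseteq> S then (real CARD('a) ^ m / real (card S)) ^ p else 0)"
proof -
  let ?ws = "map vec_fun (cols A)"
  let ?C = "\<lambda>j. {cs. length cs = length ?ws \<and> (\<Sum>i<length ?ws. fscale (cs ! i) (?ws ! i)) = vec_fun (col X j)}"
  have len: "length ?ws = m" using A by simp
  have ws: "?ws ! i = vec_fun (col A i)" if "i < m" for i using A that by simp
  have C: "?C j = {cs. length cs = m \<and> (\<Sum>i<m. fscale (cs ! i) (vec_fun (col A i))) = vec_fun (col X j)}" for j
    unfolding len by (intro Collect_cong conj_cong refl arg_cong[where f = "\<lambda>x. x = vec_fun (col X j)"] sum.cong)
      (simp add: ws)
  have "bij_betw (\<lambda>B. \<lambda>j\<in>{..<p}. map (\<lambda>i. B $$ (i, j)) [0..<m])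
      {B \<in> carrier_mat m p. A * B = X} (PiE {..<p} ?C)"
  proof (rule bij_betw_byWitness[where f' = "\<lambda>g. mat m p (\<lambda>(i, j). g j ! i)"])
    show "\<forall>B\<in>{B \<in> carrier_mat m p. A * B = X}.
        mat m p (\<lambda>(i, j). (\<lambda>j\<in>{..<p}. map (\<lambda>i. B $$ (i, j)) [0..<m]) j ! i) = B"
      by (auto intro!: eq_matI)
    show "\<forall>g\<in>PiE {..<p} ?C. (\<lambda>j\<in>{..<p}. map (\<lambda>i. mat m p (\<lambda>(i, j). g j ! i) $$ (i, j)) [0..<m]) = g"
    proof
      fix g assume g: "g \<in> PiE {..<p} ?C"
      show "(\<lambda>j\<in>{..<p}. map (\<lambda>i. mat m p (\<lambda>(i, j). g j ! i) $$ (i, j)) [0..<m]) = g"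
      proof (rule PiE_ext[OF _ g])
        have len_g: "length (g j) = m" if "j < p" for j using g that unfolding C by auto
        then have eq: "map (\<lambda>i. mat m p (\<lambda>(i, j). g j ! i) $$ (i, j)) [0..<m] = g j" if "j < p" for j
          using that by (intro nth_equalityI) auto
        show "(\<lambda>j\<in>{..<p}. map (\<lambda>i. mat m p (\<lambda>(i, j). g j ! i) $$ (i, j)) [0..<m]) \<in> PiE {..<p} ?C"
          using g by (auto simp: eq PiE_iff)
        show "(\<lambda>j\<in>{..<p}. map (\<lambda>i. mat m p (\<lambda>(i, j). g j ! i) $$ (i, j)) [0..<m]) j = g j" if "j \<in> {..<p}" for j
          using that eq by simp
      qed
    qed
    show "(\<lambda>B. \<lambda>j\<in>{..<p}. map (\<lambda>i. B $$ (i, j)) [0..<m]) ` {B \<in> carrier_mat m p. A * B = X} \<subseteq> PiE {..<p} ?C"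
    proof (rule image_subsetI)
      fix B assume "B \<in> {B \<in> carrier_mat m p. A * B = X}"
      then have "\<forall>j<p. (\<Sum>i<m. fscale (B $$ (i, j)) (vec_fun (col A i))) = vec_fun (col X j)"
        using mult_mat_eq_iff[OF A _ X, of B] by blast
      then show "(\<lambda>j\<in>{..<p}. map (\<lambda>i. B $$ (i, j)) [0..<m]) \<in> PiE {..<p} ?C"
        unfolding C by (intro restrict_PiE_iff[THEN iffD2]) simp
    qed
    show "(\<lambda>g. mat m p (\<lambda>(i, j). g j ! i)) ` PiE {..<p} ?C \<subseteq> {B \<in> carrier_mat m p. A * B = X}"
    proof (rule image_subsetI)
      fix g assume g: "g \<in> PiE {..<p} ?C"
      let ?B = "mat m p (\<lambda>(i, j). g j ! i)"
      have B: "?B \<in> carrier_mat m p" by simp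
      have "(\<Sum>i<m. fscale (?B $$ (i, j)) (vec_fun (col A i))) = vec_fun (col X j)" if "j < p" for j
      proof -
        have "(\<Sum>i<m. fscale (?B $$ (i, j)) (vec_fun (col A i))) =
            (\<Sum>i<m. fscale (g j ! i) (vec_fun (col A i)))"
          using that by (intro sum.cong) simp_all
        also have "\<dots> = vec_fun (col X j)"
          using PiE_mem[OF g, of j] that unfolding C by simp
        finally show ?thesis .
      qed
      then show "?B \<in> {B \<in> carrier_mat m p. A * B = X}"
        using B mult_mat_eq_iff[OF A B X] by blast
    qed
  qed
  then have "card {B \<in> carrier_mat m p. A * B = X} = card (PiE {..<p} ?C)"
    by (rule bij_betw_same_card)
  then have "card {B \<in> carrier_mat m p. A * B = X} = (\<Prod>j<p. card (?C j))"
    by (simp only: card_PiE finite_lessThan)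
  moreover have "real (card (?C j)) = (if vec_fun (col X j) \<in> S then real CARD('a) ^ m / real (card S) else 0)" for j
  proof -
    have "card S > 0" unfolding S_def
      using fn.span_zero by (auto simp: card_gt_0_iff)
    moreover have "card (?C j) * card S = (if vec_fun (col X j) \<in> S then CARD('a) ^ length ?ws else 0)"
      unfolding S_def by (rule fn.card_linear_system_solutions)
    then have "real (card (?C j)) * real (card S) = (if vec_fun (col X j) \<in> S then real CARD('a) ^ m else 0)"
      unfolding len of_nat_mult[symmetric] by simp
    ultimately have "real (card (?C j)) = (if vec_fun (col X j) \<in> S then real CARD('a) ^ m else 0) / real (card S)"
      by (intro nonzero_eq_divide_eq[THEN iffD2]) simp_all
    then show ?thesis unfolding if_distrib[of "\<lambda>x. x / real (card S)"] by simp
  qed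
  ultimately have "real (card {B \<in> carrier_mat m p. A * B = X}) =
      (\<Prod>j<p. if vec_fun (col X j) \<in> S then real CARD('a) ^ m / real (card S) else 0)"
    by simp
  also have "\<dots> = (if \<forall>j<p. vec_fun (col X j) \<in> S then (real CARD('a) ^ m / real (card S)) ^ p else 0)"
  proof (cases "\<forall>j<p. vec_fun (col X j) \<in> S")
    case False
    then show ?thesis by (auto intro!: prod_zero)
  qed simp
  also have "(\<forall>j<p. vec_fun (col X j) \<in> S) \<longleftrightarrow> set (map vec_fun (cols X)) \<subseteq> S"
    using X by (auto simp: cols_def)
  also have "\<dots> \<longleftrightarrow> fn.span (set (map vec_fun (cols X))) \<subseteq> S"
    unfolding S_def using fn.span_minimal fn.span_superset fn.subspace_span by (meson order_trans)
  finally show ?thesis .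
qed

section \<open>The column space and the rank\<close>

lemma vec_fun_add:
  fixes v w :: "'a :: field vec"
  shows "v \<in> carrier_vec n \<Longrightarrow> w \<in> carrier_vec n \<Longrightarrow> vec_fun (v + w) = vec_fun v + vec_fun w"
  by (auto simp: vec_fun_def fun_eq_iff)

lemma vec_fun_smult: "vec_fun (c \<cdot>\<^sub>v v) = fscale c (vec_fun v)" for v :: "'a :: field vec"
  by (auto simp: vec_fun_def fun_eq_iff fscale_apply)

lemma vec_fun_zero [simp]: "vec_fun (0\<^sub>v n) = 0"
  by (auto simp: vec_fun_def fun_eq_iff)

lemma vec_fun_image_span:
  fixes S :: "'a :: {field, finite} vec set"
  assumes S: "S \<subseteq> carrier_vec n"
  shows "fn.span (vec_fun ` S) = vec_fun ` LinearCombinations.module.span class_ring (module_vec TYPE('a) n) S"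
proof -
  interpret V: vec_space "TYPE('a)" n .
  have SC: "V.span S \<subseteq> carrier_vec n" using V.span_closed[OF S] by auto
  show ?thesis
  proof
    show "fn.span (vec_fun ` S) \<subseteq> vec_fun ` V.span S"
    proof (rule fn.span_minimal)
      show "vec_fun ` S \<subseteq> vec_fun ` V.span S"
        by (rule image_mono) (use V.in_own_span S in simp)
      show "fn.subspace (vec_fun ` V.span S)"
      proof (rule fn.subspaceI)
        show "0 \<in> vec_fun ` V.span S"
          using submodule.zero_closed[OF V.span_is_submodule] S
          by (intro image_eqI[of _ _ "0\<^sub>v n"]) simp_all
        fix x y assume "x \<in> vec_fun ` V.span S" "y \<in> vec_fun ` V.span S"
        then obtain v w where vw: "v \<in> V.span S" "w \<in> V.span S" "x = vec_fun v" "y = vec_fun w" by blast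
        then have "v + w \<in> V.span S" using V.span_add1 S by simp
        moreover have "x + y = vec_fun (v + w)"
          using vw SC by (subst vec_fun_add) auto
        ultimately show "x + y \<in> vec_fun ` V.span S" by blast
      next
        fix c x assume "x \<in> vec_fun ` V.span S"
        then show "fscale c x \<in> vec_fun ` V.span S"
          using V.smult_in_span[OF S] by (auto simp flip: vec_fun_smult)
      qed
    qed
    have "V.span S \<subseteq> {v \<in> carrier_vec n. vec_fun v \<in> fn.span (vec_fun ` S)}"
    proof (rule V.span_is_subset)
      show "S \<subseteq> {v \<in> carrier_vec n. vec_fun v \<in> fn.span (vec_fun ` S)}"
        using S by (auto intro: fn.span_base)
      show "submodule class_ring {v \<in> carrier_vec n. vec_fun v \<in> fn.span (vec_fun ` S)} V.V"
        by unfold_locales (auto simp: vec_fun_add vec_fun_smult fn.span_add fn.span_scale fn.span_zero)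
    qed
    then show "vec_fun ` V.span S \<subseteq> fn.span (vec_fun ` S)" by blast
  qed
qed

lemma card_span_vec_fun:
  fixes S :: "'a :: {field, finite} vec set"
  assumes "finite S" "S \<subseteq> carrier_vec n"
    and "LinearCombinations.module.lin_indpt class_ring (module_vec TYPE('a) n) S"
  shows "card (fn.span (vec_fun ` S)) = CARD('a) ^ card S"
  using assms
proof (induction S)
  case empty
  show ?case by simp
next
  case (insert v S)
  interpret V: vec_space "TYPE('a)" n .
  have S: "S \<subseteq> carrier_vec n" "v \<in> carrier_vec n" using insert by auto
  have indpt: "V.lin_indpt S" using insert V.subset_li_is_li by blast
  have "v \<notin> V.span S"
    using V.lin_dep_iff_in_span[of S v] insert indpt S by auto
  moreover have "V.span S \<subseteq> carrier_vec n" using V.span_closed S(1) by auto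
  ultimately have "vec_fun v \<notin> vec_fun ` V.span S"
    using bij_betw_vec_fun[of n, THEN bij_betw_imp_inj_on] S(2) by (auto simp: inj_on_def)
  then have "vec_fun v \<notin> fn.span (vec_fun ` S)" by (simp add: vec_fun_image_span[OF S(1)])
  then show ?case using fn.card_span_insert[of "vec_fun v" "vec_fun ` S"] insert indpt S by simp
qed

text \<open>The rank is the size of a maximal linearly independent set of columns, and such a set has
  the same span as all columns.\<close>

lemma card_span_cols:
  fixes X :: "'a :: {field, finite} mat"
  assumes X: "X \<in> carrier_mat n m"
  shows "card (fn.span (set (map vec_fun (cols X)))) = CARD('a) ^ vec_space.rank n X"
proof -
  interpret V: vec_space "TYPE('a)" n .
  have cols: "set (cols X) \<subseteq> carrier_vec n" using X cols_dim by blast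
  obtain S where S: "finite S" "maximal S (\<lambda>T. T \<subseteq> set (cols X) \<and> V.lin_indpt T)"
    using maximal_exists_superset[of "set (cols X)" "\<lambda>T. T \<subseteq> set (cols X) \<and> V.lin_indpt T" "{}"]
      V.finite_lin_indpt2 by auto
  have sub: "S \<subseteq> set (cols X)" and indpt: "V.lin_indpt S"
    using S(2) by (auto simp: maximal_def)
  have SC: "S \<subseteq> carrier_vec n" using sub cols by auto
  have "set (cols X) \<subseteq> V.span S"
  proof
    fix v assume v: "v \<in> set (cols X)"
    show "v \<in> V.span S"
    proof (rule ccontr)
      assume nv: "v \<notin> V.span S"
      then have "v \<notin> S" using V.in_own_span[of S] SC by auto
      have "V.lin_indpt (S \<union> {v})"
        using V.lin_dep_iff_in_span[of S v] nv indpt SC v cols \<open>v \<notin> S\<close> by auto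
      then have "S \<union> {v} = S" using S(2) sub v unfolding maximal_def by blast
      with \<open>v \<notin> S\<close> show False by blast
    qed
  qed
  then have "vec_fun ` set (cols X) \<subseteq> fn.span (vec_fun ` S)"
    unfolding vec_fun_image_span[OF SC] by blast
  moreover have "vec_fun ` S \<subseteq> fn.span (vec_fun ` set (cols X))"
    using sub fn.span_superset by blast
  ultimately have "fn.span (vec_fun ` set (cols X)) = fn.span (vec_fun ` S)"
    by (simp add: fn.span_eq)
  then show ?thesis
    using card_span_vec_fun[OF S(1) SC indpt] V.rank_card_indpt[OF X S(2)] by simp
qed

section \<open>The multiplication probability\<close>

theorem theorem3p2:
  fixes X :: "'a :: {field, finite} mat" and n q r :: nat
  assumes "CARD('a) = q"
    and "n \<ge> 1"
    and "X \<in> carrier (ring_mat TYPE('a) n ())"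
    and "vec_space.rank n X = r"
  shows "mult_prob (ring_mat TYPE('a) n ()) X =
    (\<Sum>k=r..n.
      (\<Prod>i<k-r. (real q ^ (n-r) - real q ^ i) / (real q ^ (k-r) - real q ^ i)) *
      (\<Prod>i<k. (real q ^ n - real q ^ i)) /
      real q ^ (n * (n + k)))"
proof -
  let ?M = "carrier_mat n n :: 'a mat set"
  let ?V = "coord_space n :: (nat \<Rightarrow> 'a) set"
  let ?L = "{ws. set ws \<subseteq> ?V \<and> length ws = n}"
  define U where "U = fn.span (set (map vec_fun (cols X)))"
  let ?W = "\<lambda>k. {ws \<in> ?L. U \<subseteq> fn.span (set ws) \<and> card (fn.span (set ws)) = q ^ k}"
  let ?N = "\<lambda>k. (\<Prod>i<k-r. (real q ^ (n-r) - real q ^ i) / (real q ^ (k-r) - real q ^ i)) *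
      (\<Prod>i<k. (real q ^ n - real q ^ i))"
  let ?h = "\<lambda>ws. if U \<subseteq> fn.span (set ws) then (real q ^ n / real (card (fn.span (set ws)))) ^ n else 0"
  have X: "X \<in> ?M" using assms(3) by (simp add: ring_mat_simps)
  have q: "q > 1" using fn.q_gt_1 assms(1) by metis
  have cardV: "card ?V = q ^ n" using card_coord_space assms(1) by metis
  have cardU: "card U = q ^ r" unfolding U_def card_span_cols[OF X] using assms by simp
  have bij: "bij_betw (\<lambda>A. map vec_fun (cols A)) ?M ?L" by (rule bij_betw_cols)
  have finL: "finite ?L" by (rule finite_lists_length_eq[OF finite_coord_space])
  have cardM: "card ?M = q ^ (n * n)"
    using bij_betw_same_card[OF bij] card_lists_length_eq[of ?V n, OF finite_coord_space] cardV
    by (simp add: power_mult)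
  then have finM: "finite ?M" using q by (intro card_ge_0_finite) simp
  have sub: "fn.span (set ws) \<subseteq> ?V" if "ws \<in> ?L" for ws
    using that subspace_coord_space by (intro fn.span_minimal) auto
  have "map vec_fun (cols X) \<in> ?L" using bij_betwE[OF bij] X by blast
  then have UV: "U \<subseteq> ?V" unfolding U_def by (rule sub)
  have "{(A, B). A \<in> ?M \<and> B \<in> ?M \<and> A * B = X} = (SIGMA A:?M. {B \<in> ?M. A * B = X})"
    by auto
  then have "real (card {(A, B). A \<in> ?M \<and> B \<in> ?M \<and> A * B = X}) =
      (\<Sum>A\<in>?M. real (card {B \<in> ?M. A * B = X}))"
    using finM by simp
  also have "\<dots> = (\<Sum>A\<in>?M. ?h (map vec_fun (cols A)))"
    by (rule sum.cong) (simp_all add: card_matrix_equation_solutions[OF _ X] U_def assms(1) del: set_map)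
  also have "\<dots> = (\<Sum>ws\<in>?L. ?h ws)"
    by (rule sum.reindex_bij_betw[OF bij])
  \<comment> \<open>A list whose span contains \<open>U\<close> spans a space with \<open>q ^ k\<close> elements between \<open>U\<close>
     and the whole space, so \<open>k\<close> lies between \<open>r\<close> and \<open>n\<close>.\<close>
  also have "\<dots> = (\<Sum>ws\<in>(\<Union>k\<in>{r..n}. ?W k). ?h ws)"
  proof (rule sum.mono_neutral_right[OF finL])
    show "\<forall>ws\<in>?L - (\<Union>k\<in>{r..n}. ?W k). ?h ws = 0"
    proof
      fix ws assume ws: "ws \<in> ?L - (\<Union>k\<in>{r..n}. ?W k)"
      have "\<not> U \<subseteq> fn.span (set ws)"
      proof
        assume U: "U \<subseteq> fn.span (set ws)"
        obtain k where k: "card (fn.span (set ws)) = q ^ k"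
          using fn.card_span_power[of "set ws"] assms(1) by auto
        have "q ^ r \<le> q ^ k"
          using card_mono[OF _ U] k cardU by simp
        moreover have "q ^ k \<le> q ^ n"
          using card_mono[OF finite_coord_space sub[of ws]] ws k cardV by simp
        ultimately have "k \<in> {r..n}" using power_le_imp_le_exp[OF q] by auto
        with ws U k show False by blast
      qed
      then show "?h ws = 0" by simp
    qed
  qed blast
  also have "\<dots> = (\<Sum>k=r..n. \<Sum>ws\<in>?W k. ?h ws)"
  proof (rule sum.UNION_disjoint)
    show "\<forall>k\<in>{r..n}. finite (?W k)"
      by (intro ballI, rule finite_subset[OF _ finL]) blast
    show "\<forall>k\<in>{r..n}. \<forall>l\<in>{r..n}. k \<noteq> l \<longrightarrow> ?W k \<inter> ?W l = {}"
    proof (intro ballI impI equals0I)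
      fix k l ws assume "k \<noteq> l" "ws \<in> ?W k \<inter> ?W l"
      then have "q ^ k = q ^ l" by simp
      with q \<open>k \<noteq> l\<close> show False by (simp add: power_inject_exp)
    qed
  qed simp
  also have "\<dots> = (\<Sum>k=r..n. ?N k * (real q ^ n / real q ^ k) ^ n)"
  proof (rule sum.cong[OF refl])
    fix k assume k: "k \<in> {r..n}"
    have "(\<Sum>ws\<in>?W k. ?h ws) = (\<Sum>ws\<in>?W k. (real q ^ n / real q ^ k) ^ n)"
      by (rule sum.cong[OF refl]) simp
    also have "\<dots> = real (card (?W k)) * (real q ^ n / real q ^ k) ^ n" by simp
    also have "real (card (?W k)) = ?N k"
    proof (rule fn.card_lists_span_superset[where 'a = 'a, unfolded assms(1)])
      show "fn.subspace U" unfolding U_def by (rule fn.subspace_span)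
    qed (use subspace_coord_space finite_coord_space UV cardU cardV k in simp_all)
    finally show "(\<Sum>ws\<in>?W k. ?h ws) = ?N k * (real q ^ n / real q ^ k) ^ n" .
  qed
  finally have count: "real (card {(A, B). A \<in> ?M \<and> B \<in> ?M \<and> A * B = X}) =
    (\<Sum>k=r..n. ?N k * (real q ^ n / real q ^ k) ^ n)" .
  have "(real q ^ n / real q ^ k) ^ n / (real q ^ (n * n))\<^sup>2 = 1 / real q ^ (n * (n + k))" for k
  proof -
    have "real q ^ (n * n) * real q ^ (n * (n + k)) = real q ^ (k * n) * (real q ^ (n * n))\<^sup>2"
      by (simp add: power_add power2_eq_square add_mult_distrib2 mult.commute)
    then show ?thesis
      using q by (simp add: power_divide frac_eq_eq flip: power_mult)
  qed
  then have pow: "?N k * (real q ^ n / real q ^ k) ^ n / (real q ^ (n * n))\<^sup>2 = ?N k / real q ^ (n * (n + k))" for k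
    unfolding times_divide_eq_right[symmetric] by simp
  have "mult_prob (ring_mat TYPE('a) n ()) X =
      (\<Sum>k=r..n. ?N k * (real q ^ n / real q ^ k) ^ n) / (real q ^ (n * n))\<^sup>2"
    unfolding mult_prob_def ring_mat_simps count cardM by simp
  also have "\<dots> = (\<Sum>k=r..n. ?N k / real q ^ (n * (n + k)))"
    unfolding sum_divide_distrib pow ..
  finally show ?thesis .
qed

end
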